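(* Let $L \subseteq \mathbb{R}^n$ be an $n$-dimensional lattice and let $c$ be a deep hole of $L$. Assume that all non-empty inhomogeneous shells $L(c,r) = \{x \in L : \|x-c\| = r\}$ around $c$ are spherical $2$-designs. Then there exist $\alpha_c > 0$ and $R_{\alpha_c} > 0$ such that for every $\alpha \geq \alpha_c$ and for every $z \neq c$ in the ball $B(c, R_{\alpha_c})$, the strict inequality $p(f_\alpha, L, z) > p(f_\alpha, L, c)$ holds.
   Context: $p(f_\alpha, L, z) = \sum_{x \in L} e^{-\alpha\|x-z\|^2}$, and $B(c,R)$ is the ball in $\mathbb{R}^n$ with center $c$ and radius $R$. A deep hole of $L$ is a point $c \in \mathbb{R}^n$ with $\min_{x\in L}\|x-c\| = \max_{z \in \mathbb{R}^n}\min_{x \in L}\|x-z\|$. A finite non-empty set $X$ on the sphere $\{x \in \mathbb{R}^n : \|x-z\| = r\}$ is a spherical $M$-design if for every polynomial $q$ on $\mathbb{R}^n$ of total degree at most $M$ one has $\int_{S^{n-1}(0,r)} q(y)\, d\omega(y) = \frac{1}{|X|}\sum_{x \in X} q(x-z)$, where $\omega$ is the rotationally invariant probability measure on the sphere $S^{n-1}(0,r)$ of radius $r$ centered at $0$. *)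

theory Defs
  imports "HOL-Probability.Probability"
begin

text \<open>
  A full-dimensional lattice: the integer span of a vector space basis of \<open>\<real>\<^sup>n\<close>
  (such a basis is finite, so the sums below are genuine).
\<close>
definition full_lattice :: "(real^'n) set \<Rightarrow> bool" where
  "full_lattice L \<longleftrightarrow>
     (\<exists>B. independent B \<and> span B = UNIV \<and>
          L = range (\<lambda>k :: real^'n \<Rightarrow> int. \<Sum>b\<in>B. of_int (k b) *\<^sub>R b))"

text \<open>
  \<open>infdist z L\<close> is the infimum of the distances from \<open>z\<close> to the points of \<open>L\<close>. A lattice is
  closed and non-empty, so this is \<open>min\<^bsub>x\<in>L\<^esub> \<parallel>x - z\<parallel>\<close>.
\<close>
definition deep_hole :: "(real^'n) set \<Rightarrow> real^'n \<Rightarrow> bool" where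
  "deep_hole L c \<longleftrightarrow> (\<forall>z. infdist z L \<le> infdist c L)"

text \<open>
  The sum converges for \<open>\<alpha> > 0\<close> and a lattice \<open>L\<close>, so the default value \<open>0\<close> of non-summable sums
  plays no role.
\<close>
definition gaussian_potential :: "real \<Rightarrow> (real^'n) set \<Rightarrow> real^'n \<Rightarrow> real" where
  "gaussian_potential \<alpha> L z = (\<Sum>\<^sub>\<infinity>x\<in>L. exp (- \<alpha> * (norm (x - z))\<^sup>2))"

definition shell :: "(real^'n) set \<Rightarrow> real^'n \<Rightarrow> real \<Rightarrow> (real^'n) set" where
  "shell L c r = {x \<in> L. norm (x - c) = r}"

text \<open>
  Measures on the sphere of radius \<open>r\<close> around \<open>0\<close> are represented by Borel measures on the whole
  space that are concentrated on that sphere. Rotations are all orthogonal maps, which makes the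
  invariant probability measure unique in dimension one as well.
\<close>
definition rotation_invariant_prob :: "real \<Rightarrow> (real^'n) measure \<Rightarrow> bool" where
  "rotation_invariant_prob r M \<longleftrightarrow>
     prob_space M \<and> sets M = sets borel \<and> (AE x in M. norm x = r) \<and>
     (\<forall>T. orthogonal_transformation T \<longrightarrow> distr M borel T = M)"

definition sphere_measure :: "real \<Rightarrow> (real^'n) measure" where
  "sphere_measure r = (THE M. rotation_invariant_prob r M)"

definition poly_fun_deg_le :: "nat \<Rightarrow> (real^'n \<Rightarrow> real) \<Rightarrow> bool" where
  "poly_fun_deg_le M q \<longleftrightarrow>
     (\<exists>a :: ('n \<Rightarrow> nat) \<Rightarrow> real.
        q = (\<lambda>x. \<Sum>e | (\<Sum>i\<in>UNIV. e i) \<le> M. a e * (\<Prod>i\<in>UNIV. (x $ i) ^ e i)))"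

definition spherical_design :: "nat \<Rightarrow> real^'n \<Rightarrow> real \<Rightarrow> (real^'n) set \<Rightarrow> bool" where
  "spherical_design M z r X \<longleftrightarrow>
     finite X \<and> X \<noteq> {} \<and> X \<subseteq> sphere z r \<and>
     (\<forall>q. poly_fun_deg_le M q \<longrightarrow>
        (\<integral>y. q y \<partial>sphere_measure r) = 1 / real (card X) * (\<Sum>x\<in>X. q (x - z)))"

text \<open>The index set in \<^const>\<open>poly_fun_deg_le\<close> is finite, so the sum is a genuine one.\<close>
lemma finite_exponents_le: "finite {e :: 'n::finite \<Rightarrow> nat. (\<Sum>i\<in>UNIV. e i) \<le> M}"
proof (rule finite_subset)
  have "e i \<le> M" if "(\<Sum>i\<in>UNIV. e i) \<le> M" for e :: "'n \<Rightarrow> nat" and i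
    using that member_le_sum[of i UNIV e] by simp
  then show "{e :: 'n \<Rightarrow> nat. (\<Sum>i\<in>UNIV. e i) \<le> M} \<subseteq> (\<Pi>\<^sub>E i\<in>UNIV. {..M})"
    by (simp add: subset_iff PiE_iff)
  show "finite (\<Pi>\<^sub>E i\<in>(UNIV :: 'n set). {..M})" by (intro finite_PiE) simp_all
qed

text \<open>
  The rotation invariant probability measure on a sphere exists and is unique, so the definite
  description in \<^const>\<open>sphere_measure\<close> is meaningful. Both parts rest on the fact that two
  measures giving all balls of equal radius the same mass coincide.
\<close>
lemma uniform_measure_le:
  fixes M N :: "'a::euclidean_space measure"
  assumes sM: "sets M = sets borel" and sN: "sets N = sets borel"
    and "sigma_finite_measure M" "sigma_finite_measure N"
    and AM: "AE x in M. x \<in> S" and AN: "AE x in N. x \<in> S"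
    and B: "\<And>e. e > 0 \<Longrightarrow> \<exists>c. 0 < c \<and> c < \<infinity> \<and>
              (\<forall>x\<in>S. emeasure M (ball x e) = c \<and> emeasure N (ball x e) = c)"
    and fin: "\<And>K. compact K \<Longrightarrow> emeasure M K < \<infinity>"
    and C: "compact C"
  shows "emeasure N C \<le> emeasure M C"
proof (cases "C = {}")
  case False
  interpret M: sigma_finite_measure M by fact
  interpret N: sigma_finite_measure N by fact
  interpret pair_sigma_finite M N ..
  note [measurable_cong] = sM sN
  have [measurable]: "C \<in> sets borel" using C by (simp add: borel_compact)
  define D where "D e = {x. infdist x C \<le> e}" for e
  have Dcl: "closed (D e)" for e
    unfolding D_def by (intro closed_Collect_le continuous_intros)
  have Dm[measurable]: "D e \<in> sets borel" for e using Dcl by (rule borel_closed)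
  have *: "emeasure N C \<le> emeasure M (D e)" if e: "e > 0" for e
  proof -
    obtain c where c: "0 < c" "c < \<infinity>"
      and cM: "\<And>x. x \<in> S \<Longrightarrow> emeasure M (ball x e) = c"
      and cN: "\<And>x. x \<in> S \<Longrightarrow> emeasure N (ball x e) = c"
      using B[OF e] by blast
    define f :: "'a \<Rightarrow> 'a \<Rightarrow> ennreal"
      where "f x y = indicator C y * indicator {z. dist (fst z) (snd z) < e} (x, y)" for x y
    have "Measurable.pred (borel \<Otimes>\<^sub>M borel) (\<lambda>z::'a\<times>'a. dist (fst z) (snd z) < e)"
      by measurable
    then have [measurable]: "{z::'a\<times>'a. dist (fst z) (snd z) < e} \<in> sets (borel \<Otimes>\<^sub>M borel)"
      by (simp add: pred_def space_pair_measure)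
    have fm: "case_prod f \<in> borel_measurable (M \<Otimes>\<^sub>M N)"
      unfolding f_def by measurable
    have f1: "(\<integral>\<^sup>+x. f x y \<partial>M) = indicator C y * emeasure M (ball y e)" for y
    proof -
      have "(\<integral>\<^sup>+x. f x y \<partial>M) = (\<integral>\<^sup>+x. indicator C y * indicator (ball y e) x \<partial>M)"
        by (intro nn_integral_cong) (auto simp: f_def indicator_def dist_commute)
      then show ?thesis by (simp add: nn_integral_cmult_indicator sM)
    qed
    have f2: "(\<integral>\<^sup>+y. f x y \<partial>N) \<le> indicator (D e) x * emeasure N (ball x e)" for x
    proof -
      have "(\<integral>\<^sup>+y. f x y \<partial>N) \<le> (\<integral>\<^sup>+y. indicator (D e) x * indicator (ball x e) y \<partial>N)"
        by (intro nn_integral_mono)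
          (auto simp: f_def indicator_def D_def intro: infdist_le2)
      then show ?thesis by (simp add: nn_integral_cmult_indicator sN)
    qed
    have "c * emeasure N C = (\<integral>\<^sup>+y. c * indicator C y \<partial>N)"
      by (simp add: nn_integral_cmult_indicator sN)
    also have "\<dots> = (\<integral>\<^sup>+y. (\<integral>\<^sup>+x. f x y \<partial>M) \<partial>N)"
      using AN by (intro nn_integral_cong_AE) (auto simp: f1 cM mult.commute)
    also have "\<dots> = (\<integral>\<^sup>+x. (\<integral>\<^sup>+y. f x y \<partial>N) \<partial>M)"
      by (rule Fubini'[OF fm])
    also have "\<dots> \<le> (\<integral>\<^sup>+x. indicator (D e) x * emeasure N (ball x e) \<partial>M)"
      by (intro nn_integral_mono f2)
    also have "\<dots> = (\<integral>\<^sup>+x. c * indicator (D e) x \<partial>M)"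
      using AM by (intro nn_integral_cong_AE) (auto simp: cN mult.commute)
    also have "\<dots> = c * emeasure M (D e)"
      by (simp add: nn_integral_cmult_indicator sM)
    finally show ?thesis using c
      by (simp add: ennreal_mult_le_mult_iff)
  qed
  define A where "A k = D (1 / real (Suc k))" for k
  have "bounded (D 1)"
  proof -
    obtain b where b: "\<And>y. y \<in> C \<Longrightarrow> norm y \<le> b"
      using compact_imp_bounded[OF C] unfolding bounded_iff by blast
    have "norm x \<le> b + 1" if "x \<in> D 1" for x
    proof -
      obtain y where "y \<in> C" "infdist x C = dist x y"
        using infdist_attains_inf[OF compact_imp_closed[OF C] False] by blast
      then have "dist x y \<le> 1" using that by (simp add: D_def)
      then show ?thesis using b[OF \<open>y \<in> C\<close>] norm_triangle_sub[of x y] by (simp add: dist_norm)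
    qed
    then show ?thesis unfolding bounded_iff by blast
  qed
  then have D1: "emeasure M (D 1) < \<infinity>"
    using fin Dcl by (simp add: compact_eq_bounded_closed)
  have "(\<lambda>k. emeasure M (A k)) \<longlonglongrightarrow> emeasure M (\<Inter>k. A k)"
  proof (rule Lim_emeasure_decseq)
    show "range A \<subseteq> sets M" by (auto simp: A_def sM)
    have mono: "D a \<subseteq> D b" if "a \<le> b" for a b using that by (auto simp: D_def)
    show "decseq A"
      unfolding decseq_def A_def by (intro allI impI mono) (simp add: frac_le)
    fix k
    have "emeasure M (A k) \<le> emeasure M (D 1)"
      unfolding A_def by (intro emeasure_mono mono) (auto simp: sM)
    then show "emeasure M (A k) \<noteq> \<infinity>" using D1 by (auto simp: top_unique)
  qed
  moreover have "(\<Inter>k. A k) = C"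
  proof -
    have "infdist x C \<le> 0" if "\<forall>k. infdist x C \<le> 1 / real (Suc k)" for x
    proof (rule LIMSEQ_le_const[OF LIMSEQ_inverse_real_of_nat])
      show "\<exists>N. \<forall>n\<ge>N. infdist x C \<le> inverse (real (Suc n))"
        using that by (simp add: inverse_eq_divide)
    qed
    then have "infdist x C = 0" if "\<forall>k. infdist x C \<le> 1 / real (Suc k)" for x
      using that by (intro antisym infdist_nonneg)
    then have "x \<in> C" if "\<forall>k. infdist x C \<le> 1 / real (Suc k)" for x
      using that in_closed_iff_infdist_zero[OF compact_imp_closed[OF C] False] by blast
    then have "(\<Inter>k. A k) \<subseteq> C" unfolding A_def D_def by blast
    moreover have "C \<subseteq> A k" for k unfolding A_def D_def by auto
    ultimately show ?thesis by blast
  qed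
  ultimately have lim: "(\<lambda>k. emeasure M (A k)) \<longlonglongrightarrow> emeasure M C" by simp
  have "emeasure N C \<le> emeasure M (A k)" for k
    unfolding A_def by (rule *) simp
  then show ?thesis by (intro LIMSEQ_le_const[OF lim]) blast
qed simp

lemma uniform_measure_unique:
  fixes M N :: "'a::euclidean_space measure"
  assumes "sets M = sets borel" "sets N = sets borel"
    and "sigma_finite_measure M" "sigma_finite_measure N"
    and "AE x in M. x \<in> S" "AE x in N. x \<in> S"
    and B: "\<And>e. e > 0 \<Longrightarrow> \<exists>c. 0 < c \<and> c < \<infinity> \<and>
              (\<forall>x\<in>S. emeasure M (ball x e) = c \<and> emeasure N (ball x e) = c)"
    and fin: "\<And>K. compact K \<Longrightarrow> emeasure M K < \<infinity>" "\<And>K. compact K \<Longrightarrow> emeasure N K < \<infinity>"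
  shows "M = N"
proof -
  let ?E = "Collect (compact :: 'a set \<Rightarrow> bool)"
  have B': "\<exists>c. 0 < c \<and> c < \<infinity> \<and>
              (\<forall>x\<in>S. emeasure N (ball x e) = c \<and> emeasure M (ball x e) = c)" if "e > 0" for e
    using B[OF that] by blast
  have gen: "sets borel = sigma_sets UNIV ?E"
  proof -
    have "X \<in> sigma_sets UNIV ?E" if "closed X" for X
    proof -
      have "X = (\<Union>i. X \<inter> cball 0 (real i))"
        by (auto simp: real_arch_simple)
      moreover have "compact (X \<inter> cball 0 (real i))" for i
        using that by (simp add: closed_Int_compact)
      ultimately show ?thesis
        by (metis (no_types, lifting) mem_Collect_eq sigma_sets.Basic sigma_sets.Union)
    qed
    then have "sigma_sets UNIV (Collect closed) \<subseteq> sigma_sets UNIV ?E"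
      by (intro sigma_sets_mono) auto
    moreover have "sigma_sets UNIV ?E \<subseteq> sigma_sets UNIV (Collect closed)"
      by (intro sigma_sets_mono) (auto intro: compact_imp_closed)
    ultimately show ?thesis
      by (simp add: borel_eq_closed)
  qed
  show ?thesis
  proof (rule measure_eqI_generator_eq[where E = ?E and \<Omega> = UNIV and A = "\<lambda>i. cball 0 (real i)"])
    show "Int_stable ?E" by (auto simp: Int_stable_def compact_Int)
    show "emeasure M X = emeasure N X" if "X \<in> ?E" for X
    proof (rule antisym)
      show "emeasure M X \<le> emeasure N X"
        using that by (intro uniform_measure_le[where S = S] B' fin assms) auto
      show "emeasure N X \<le> emeasure M X"
        using that by (intro uniform_measure_le[where S = S] B fin assms) auto
    qed
    show "(\<Union>i. cball (0::'a) (real i)) = UNIV" by (auto simp: real_arch_simple)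
    show "emeasure M (cball 0 (real i)) \<noteq> \<infinity>" for i
      using fin(1)[of "cball 0 (real i)"] by simp
  qed (use assms gen in auto)
qed

lemma orthogonal_vimage_ball:
  assumes T: "orthogonal_transformation T"
  shows "T -` ball (T x) e = ball x e"
proof -
  have "dist (T x) (T y) = dist x y" for y
    using T by (metis dist_norm linear_diff orthogonal_transformation_linear orthogonal_transformation_norm)
  then show ?thesis by auto
qed

lemma lborel_distr_orthogonal:
  fixes T :: "real^'n \<Rightarrow> real^'n"
  assumes T: "orthogonal_transformation T"
  shows "distr lborel borel T = lborel"
proof -
  have lin: "linear T" using T by (simp add: orthogonal_transformation_linear)
  have [measurable]: "T \<in> borel_measurable borel"
    using lin by (intro borel_measurable_continuous_onI linear_continuous_on)
      (simp add: linear_conv_bounded_linear)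
  have n: "norm (T x) = norm x" for x using T by (simp add: orthogonal_transformation_norm)
  have surj: "surj T" using T by (rule orthogonal_transformation_surj)
  have fin: "emeasure (distr lborel borel T) K < \<infinity>" if K: "compact K" for K
  proof -
    obtain b where b: "K \<subseteq> cball 0 b"
      using compact_imp_bounded[OF K] unfolding bounded_iff by (auto simp: subset_iff)
    have "emeasure (distr lborel borel T) K \<le> emeasure (distr lborel borel T) (cball 0 b)"
      using b by (intro emeasure_mono) auto
    also have "\<dots> = emeasure lborel (cball (0 :: real^'n) b)"
      by (subst emeasure_distr) (auto intro!: arg_cong[where f = "emeasure lborel"] simp: n)
    also have "\<dots> < \<infinity>" by (rule emeasure_lborel_cball_finite)
    finally show ?thesis .
  qed
  show ?thesis
  proof (rule uniform_measure_unique[where S = UNIV])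
    show "sigma_finite_measure (distr lborel borel T)"
    proof
      show "\<exists>A. countable A \<and> A \<subseteq> sets (distr lborel borel T) \<and> \<Union> A = space (distr lborel borel T)
            \<and> (\<forall>a\<in>A. emeasure (distr lborel borel T) a \<noteq> \<infinity>)"
      proof (intro exI[of _ "range (\<lambda>i. cball (0 :: real^'n) (real i))"] conjI ballI)
        show "\<Union> (range (\<lambda>i. cball (0 :: real^'n) (real i))) = space (distr lborel borel T)"
          by (auto simp: real_arch_simple)
        show "emeasure (distr lborel borel T) a \<noteq> \<infinity>"
          if "a \<in> range (\<lambda>i. cball (0 :: real^'n) (real i))" for a
          using that less_imp_neq[OF fin[of a]] compact_cball by blast
      qed auto
    qed
    show "\<exists>c. 0 < c \<and> c < \<infinity> \<and> (\<forall>x\<in>UNIV. emeasure (distr lborel borel T) (ball x e) = c \<and>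
            emeasure lborel (ball x e) = c)" if e: "e > 0" for e
    proof -
      let ?c = "emeasure lborel (ball (0 :: real^'n) e)"
      have b: "emeasure lborel (ball x e) = ?c" for x :: "real^'n"
        using e by (simp add: emeasure_ball)
      have "emeasure (distr lborel borel T) (ball x e) = ?c" for x
      proof -
        obtain y where y: "x = T y" using surj by (metis surjD)
        have "emeasure (distr lborel borel T) (ball x e) = emeasure lborel (ball y e)"
          by (simp add: emeasure_distr orthogonal_vimage_ball[OF T] y)
        also have "\<dots> = ?c" by (rule b)
        finally show ?thesis .
      qed
      moreover have "?c < \<infinity>" by (rule emeasure_lborel_ball_finite)
      moreover have "?c \<noteq> 0"
        using content_ball_pos[OF e, of "0 :: real^'n"] by (auto simp: measure_def)
      then have "0 < ?c" by (simp add: zero_less_iff_neq_zero)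
      ultimately show ?thesis using b by blast
    qed
    show "emeasure lborel K < \<infinity>" if "compact K" for K :: "(real^'n) set"
      using that by (rule emeasure_compact_finite)
    show "emeasure (distr lborel borel T) K < \<infinity>" if "compact K" for K
      using that by (rule fin)
  qed (auto intro: sigma_finite_lborel)
qed

lemma rotation_invariant_prob_exists:
  assumes r: "r \<ge> 0"
  shows "\<exists>M :: (real^'n) measure. rotation_invariant_prob r M"
proof -
  let ?U = "uniform_measure lborel (cball (0 :: real^'n) 1)"
  let ?p = "\<lambda>x :: real^'n. (r / norm x) *\<^sub>R x"
  have c0: "emeasure lborel (cball (0 :: real^'n) 1) \<noteq> 0"
    using content_cball_pos[of 1 "0 :: real^'n"] by (auto simp: measure_def)
  have cf: "emeasure lborel (cball (0 :: real^'n) 1) \<noteq> \<infinity>"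
    using emeasure_lborel_cball_finite[of "0 :: real^'n" 1] by simp
  interpret U: prob_space ?U using c0 cf by (rule prob_space_uniform_measure)
  have [measurable]: "?p \<in> borel_measurable borel" by measurable
  have pm: "?p \<in> measurable ?U borel" by simp
  have "AE x in lborel. x \<noteq> (0 :: real^'n)"
    by (rule AE_lborel_singleton)
  then have "AE x in ?U. x \<noteq> 0"
    by (intro AE_uniform_measureI) auto
  then have "AE x in ?U. norm (?p x) = r"
    by eventually_elim (use r in simp)
  then have AE: "AE x in distr ?U borel ?p. norm x = r"
    by (subst AE_distr_iff[OF pm]) auto
  have inv: "distr (distr ?U borel ?p) borel T = distr ?U borel ?p"
    if T: "orthogonal_transformation T" for T
  proof -
    have lin: "linear T" using T by (simp add: orthogonal_transformation_linear)
    have [measurable]: "T \<in> borel_measurable borel"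
      using lin by (intro borel_measurable_continuous_onI linear_continuous_on)
        (simp add: linear_conv_bounded_linear)
    have n: "norm (T x) = norm x" for x using T by (simp add: orthogonal_transformation_norm)
    have U: "distr ?U borel T = ?U"
    proof (rule measure_eqI)
      fix A assume "A \<in> sets (distr ?U borel T)"
      then have [measurable]: "A \<in> sets borel" by simp
      have [measurable]: "T -` A \<in> sets borel"
        using measurable_sets[of T borel borel A] by simp
      have "cball 0 1 \<inter> T -` A = T -` (cball 0 1 \<inter> A)" by (auto simp: n)
      then have "emeasure lborel (cball 0 1 \<inter> T -` A) = emeasure (distr lborel borel T) (cball 0 1 \<inter> A)"
        by (simp add: emeasure_distr)
      then show "emeasure (distr ?U borel T) A = emeasure ?U A"
        by (simp add: emeasure_distr lborel_distr_orthogonal[OF T])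
    qed simp
    have "distr (distr ?U borel ?p) borel T = distr ?U borel (\<lambda>x. ?p (T x))"
      by (subst distr_distr) (auto simp: o_def n linear_scale[OF lin])
    also have "\<dots> = distr (distr ?U borel T) borel ?p"
      by (subst distr_distr) (auto simp: o_def)
    finally show ?thesis by (simp add: U)
  qed
  have "rotation_invariant_prob r (distr ?U borel ?p)"
    unfolding rotation_invariant_prob_def
    using U.prob_space_distr[OF pm] AE inv by simp
  then show ?thesis by blast
qed

lemma rotation_invariant_prob_ball:
  fixes M :: "(real^'n) measure"
  assumes M: "rotation_invariant_prob r M" and "norm x = r" "norm y = r"
  shows "emeasure M (ball x e) = emeasure M (ball y e)"
proof -
  obtain T where T: "orthogonal_transformation T" "T x = y"
    using orthogonal_transformation_exists[of x y] assms by auto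
  have lin: "linear T" using T by (simp add: orthogonal_transformation_linear)
  have "T \<in> borel_measurable borel"
    using lin by (intro borel_measurable_continuous_onI linear_continuous_on)
      (simp add: linear_conv_bounded_linear)
  then have Tm: "T \<in> measurable M borel" if "sets M = sets borel"
    using that by (simp cong: measurable_cong_sets)
  have sM: "sets M = sets borel" and "distr M borel T = M"
    using M T by (auto simp: rotation_invariant_prob_def)
  then have "emeasure M (ball y e) = emeasure (distr M borel T) (ball y e)" by simp
  also have "\<dots> = emeasure M (T -` ball y e \<inter> space M)"
    by (rule emeasure_distr[OF Tm[OF sM]]) simp
  also have "T -` ball y e \<inter> space M = ball x e"
    using orthogonal_vimage_ball[OF T(1), of x e] T(2) sets_eq_imp_space_eq[OF sM] by simp
  finally show ?thesis by simp
qed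

lemma rotation_invariant_prob_ball_pos:
  fixes M :: "(real^'n) measure"
  assumes M: "rotation_invariant_prob r M" and x: "norm x = r" and e: "e > 0"
  shows "emeasure M (ball x e) > 0"
proof (rule ccontr)
  assume "\<not> ?thesis"
  then have z: "emeasure M (ball y e) = 0" if "norm y = r" for y
    using rotation_invariant_prob_ball[OF M x that] by simp
  interpret prob_space M using M by (simp add: rotation_invariant_prob_def)
  have sM: "sets M = sets borel" and AE: "AE x in M. norm x = r"
    using M by (auto simp: rotation_invariant_prob_def)
  have cover: "sphere (0 :: real^'n) r \<subseteq> (\<Union>y\<in>sphere 0 r. ball y e)" using e by auto
  obtain F :: "(real^'n) set"
    where F: "F \<subseteq> sphere 0 r" "finite F" "sphere 0 r \<subseteq> (\<Union>y\<in>F. ball y e)"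
    by (rule compactE_image[OF compact_sphere _ cover]) (rule open_ball, rule that)
  have "(\<Union>y\<in>F. ball y e) \<in> null_sets M"
    using F z by (intro null_sets.finite_UN) (auto simp: null_sets_def sM)
  then have "AE x in M. x \<notin> (\<Union>y\<in>F. ball y e)" by (rule AE_not_in)
  with AE have "AE x in M. False"
    by eventually_elim (use F in auto)
  then show False by (simp add: AE_False)
qed

lemma rotation_invariant_prob_unique:
  fixes M N :: "(real^'n) measure"
  assumes M: "rotation_invariant_prob r M" and N: "rotation_invariant_prob r N"
  shows "M = N"
proof -
  interpret M: prob_space M using M by (simp add: rotation_invariant_prob_def)
  interpret N: prob_space N using N by (simp add: rotation_invariant_prob_def)
  interpret pair_sigma_finite M N ..
  have sM: "sets M = sets borel" and AM: "AE x in M. norm x = r"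
    using M by (auto simp: rotation_invariant_prob_def)
  have sN: "sets N = sets borel" and AN: "AE x in N. norm x = r"
    using N by (auto simp: rotation_invariant_prob_def)
  note [measurable_cong] = sM sN
  show ?thesis
  proof (rule uniform_measure_unique[where S = "sphere 0 r"])
    fix e :: real assume e: "e > 0"
    obtain x0 :: "real^'n" where x0: "norm x0 = r"
    proof -
      have "\<exists>x :: real^'n. norm x = r"
      proof (rule ccontr)
        assume "\<nexists>x :: real^'n. norm x = r"
        with AM have "AE x in M. False" by simp
        then show False by (simp add: M.AE_False)
      qed
      then show ?thesis using that by blast
    qed
    let ?m = "emeasure M (ball x0 e)" and ?n = "emeasure N (ball x0 e)"
    define f :: "real^'n \<Rightarrow> real^'n \<Rightarrow> ennreal"
      where "f x y = indicator {z. dist (fst z) (snd z) < e} (x, y)" for x y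
    have "Measurable.pred (borel \<Otimes>\<^sub>M borel) (\<lambda>z::(real^'n)\<times>(real^'n). dist (fst z) (snd z) < e)"
      by measurable
    then have [measurable]:
        "{z::(real^'n)\<times>(real^'n). dist (fst z) (snd z) < e} \<in> sets (borel \<Otimes>\<^sub>M borel)"
      by (simp add: pred_def space_pair_measure)
    have fm: "case_prod f \<in> borel_measurable (M \<Otimes>\<^sub>M N)"
      unfolding f_def by measurable
    have f1: "(\<integral>\<^sup>+x. f x y \<partial>M) = emeasure M (ball y e)" for y
    proof -
      have "(\<integral>\<^sup>+x. f x y \<partial>M) = (\<integral>\<^sup>+x. indicator (ball y e) x \<partial>M)"
        by (intro nn_integral_cong) (auto simp: f_def indicator_def dist_commute)
      then show ?thesis by (simp add: sM)
    qed
    have f2: "(\<integral>\<^sup>+y. f x y \<partial>N) = emeasure N (ball x e)" for x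
    proof -
      have "(\<integral>\<^sup>+y. f x y \<partial>N) = (\<integral>\<^sup>+y. indicator (ball x e) y \<partial>N)"
        by (intro nn_integral_cong) (auto simp: f_def indicator_def)
      then show ?thesis by (simp add: sN)
    qed
    have "?m = (\<integral>\<^sup>+y. ?m \<partial>N)" by (simp add: N.emeasure_space_1)
    also have "\<dots> = (\<integral>\<^sup>+y. (\<integral>\<^sup>+x. f x y \<partial>M) \<partial>N)"
      unfolding f1 using AN
      by (intro nn_integral_cong_AE)
        (auto intro: rotation_invariant_prob_ball[OF M x0])
    also have "\<dots> = (\<integral>\<^sup>+x. (\<integral>\<^sup>+y. f x y \<partial>N) \<partial>M)"
      by (rule Fubini'[OF fm])
    also have "\<dots> = (\<integral>\<^sup>+x. ?n \<partial>M)"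
      unfolding f2 using AM
      by (intro nn_integral_cong_AE)
        (auto intro: rotation_invariant_prob_ball[OF N _ x0])
    also have "\<dots> = ?n" by (simp add: M.emeasure_space_1)
    finally have mn: "?m = ?n" .
    have "\<forall>x\<in>sphere 0 r. emeasure M (ball x e) = ?m \<and> emeasure N (ball x e) = ?m"
      using rotation_invariant_prob_ball[OF M _ x0] rotation_invariant_prob_ball[OF N _ x0] mn
      by simp
    moreover have "0 < ?m" by (rule rotation_invariant_prob_ball_pos[OF M x0 e])
    moreover have "?m < \<infinity>" by (simp add: M.emeasure_finite less_top[symmetric])
    ultimately show "\<exists>c. 0 < c \<and> c < \<infinity> \<and>
        (\<forall>x\<in>sphere 0 r. emeasure M (ball x e) = c \<and> emeasure N (ball x e) = c)" by blast
  qed (use AM AN in \<open>auto simp: sM sN M.emeasure_finite N.emeasure_finite less_top[symmetric]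
         M.sigma_finite_measure_axioms N.sigma_finite_measure_axioms\<close>)
qed

lemma rotation_invariant_prob_sphere_measure:
  assumes "r \<ge> 0"
  shows "rotation_invariant_prob r (sphere_measure r :: (real^'n) measure)"
  unfolding sphere_measure_def
proof (rule theI'[OF ex_ex1I])
  show "\<exists>M :: (real^'n) measure. rotation_invariant_prob r M"
    using assms by (rule rotation_invariant_prob_exists)
  show "M = N" if "rotation_invariant_prob r M" "rotation_invariant_prob r N"
    for M N :: "(real^'n) measure"
    using that by (rule rotation_invariant_prob_unique)
qed

end

theory Submission
  imports Defs
begin

text \<open>
  Put \<open>w = z - c\<close> and \<open>t\<^sub>x = 2 \<alpha> ((x - c) \<bullet> w)\<close>. Then
  \<open>p(f\<^sub>\<alpha>, L, z) = exp (- \<alpha> \<parallel>w\<parallel>\<^sup>2) \<Sum>\<^sub>x exp (- \<alpha> \<parallel>x - c\<parallel>\<^sup>2) exp t\<^sub>x\<close>. The design property kills the terms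
  linear in \<open>t\<^sub>x\<close>, and \<open>exp t - 1 - t\<close> is nonnegative. In the innermost shell, of radius \<open>r > 0\<close>, the
  second moments provide a point with \<open>t\<^sub>x \<ge> 2 \<alpha> r \<parallel>w\<parallel> / n\<close>. For \<open>\<parallel>w\<parallel> \<le> r / n\<close> and large \<open>\<alpha>\<close> its term
  \<open>exp t - 1 - t \<ge> t\<^sup>2 / 8 * exp (t / 2)\<close> alone outweighs the loss through the factor
  \<open>exp (- \<alpha> \<parallel>w\<parallel>\<^sup>2)\<close>, because \<open>p(f\<^sub>\<alpha>, L, c)\<close> is at most a constant times \<open>exp (- \<alpha> r\<^sup>2)\<close> for \<open>\<alpha> \<ge> 1\<close>.
\<close>

subsection \<open>Gaussian sums over lattices\<close>

lemma summable_on_exp_int: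
  assumes "\<gamma> > 0"
  shows "(\<lambda>k::int. exp (- \<gamma> * \<bar>real_of_int k\<bar>)) summable_on UNIV"
proof -
  let ?g = "\<lambda>k::int. exp (- \<gamma> * \<bar>real_of_int k\<bar>)"
  have "(\<lambda>n. exp (- \<gamma>) ^ n) summable_on (UNIV :: nat set)"
    using assms by (intro norm_summable_imp_summable_on) (simp add: summable_geometric)
  then have n: "(\<lambda>n. exp (- \<gamma> * real n)) summable_on (UNIV :: nat set)"
    by (simp add: exp_of_nat_mult[symmetric] mult.commute)
  have "?g summable_on range int"
    using n by (subst summable_on_reindex) (auto simp: o_def)
  \<comment> \<open>The negative half is parametrised by \<open>- int (Suc n)\<close>, so 0 belongs
    to the first geometric series alone.\<close>
  moreover have "?g summable_on range (\<lambda>n. - int (Suc n))"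
  proof (subst summable_on_reindex)
    show "inj (\<lambda>n. - int (Suc n))" by (auto simp: inj_on_def)
    have "(\<lambda>n. exp (- \<gamma>) * exp (- \<gamma> * real n)) summable_on (UNIV :: nat set)"
      using n by (rule summable_on_cmult_right)
    then show "(?g \<circ> (\<lambda>n. - int (Suc n))) summable_on UNIV"
      by (simp add: o_def exp_add[symmetric] algebra_simps)
  qed
  moreover have "range int \<union> range (\<lambda>n. - int (Suc n)) = UNIV"
  proof -
    have "k \<in> range int \<union> range (\<lambda>n. - int (Suc n))" for k
      by (cases k rule: int_cases) auto
    then show ?thesis by blast
  qed
  moreover have "range int \<inter> range (\<lambda>n. - int (Suc n)) = {}" by auto
  ultimately show ?thesis
    using summable_on_Un_disjoint by metis
qed

text \<open>Coordinates with respect to the lattice basis are linear in the point, so their absolute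
  values add up to at most a constant times the norm. The Gaussian is therefore dominated by a
  product of exponentials, one per integer coordinate, and each factor is summable over the
  integers.\<close>

lemma full_lattice_gaussian_summable:
  fixes L :: "(real^'n) set"
  assumes L: "full_lattice L" and \<alpha>: "\<alpha> > 0"
  shows "(\<lambda>x. exp (- \<alpha> * (norm (x - z))\<^sup>2)) summable_on L"
proof -
  obtain B :: "(real^'n) set" where B: "independent B" "span B = UNIV"
    and LB: "L = range (\<lambda>k :: real^'n \<Rightarrow> int. \<Sum>b\<in>B. of_int (k b) *\<^sub>R b)"
    using L unfolding full_lattice_def by blast
  have fB: "finite B" using B(1) by (rule independent_imp_finite)
  \<comment> \<open>On \<open>L\<close> the coordinates are integers already, and the floor merely
    converts their type. Restriction to \<open>B\<close> makes the coordinate vectors extensional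
    functions, as the product index set below requires.\<close>
  define \<rho> where "\<rho> x = (\<lambda>b\<in>B. \<lfloor>representation B x b\<rfloor>)" for x
  have rep: "(\<Sum>b\<in>B. representation B x b *\<^sub>R b) = x" for x
    using B fB by (intro real_vector.sum_representation_eq) auto
  have int: "representation B x b = of_int (\<rho> x b)" if "x \<in> L" "b \<in> B" for x b
  proof -
    obtain k :: "real^'n \<Rightarrow> int" where k: "x = (\<Sum>b\<in>B. of_int (k b) *\<^sub>R b)"
      using \<open>x \<in> L\<close> LB by auto
    have "representation B x b = (\<Sum>b'\<in>B. of_int (k b') * representation B b' b)"
      unfolding k using B
      by (simp add: real_vector.representation_sum real_vector.representation_scale)
    also have "\<dots> = (\<Sum>b'\<in>B. if b' = b then of_int (k b') else 0)"
      using B(1) that(2) by (intro sum.cong) (auto simp: real_vector.representation_basis)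
    also have "\<dots> = of_int (k b)" using fB that(2) by simp
    finally show ?thesis using that(2) by (simp add: \<rho>_def)
  qed
  have inj: "inj_on \<rho> L"
  proof (rule inj_onI)
    fix x y assume "x \<in> L" "y \<in> L" "\<rho> x = \<rho> y"
    then have "(\<Sum>b\<in>B. representation B x b *\<^sub>R b) = (\<Sum>b\<in>B. representation B y b *\<^sub>R b)"
      by (intro sum.cong) (simp_all add: int)
    then show "x = y" by (simp only: rep)
  qed
  have "\<exists>C>0. \<forall>x. \<bar>representation B x b\<bar> \<le> norm x * C" for b
  proof -
    have "linear (\<lambda>x. representation B x b)"
      using real_vector.linear_representation[OF B]
      by (simp add: linear_def real_scaleR_def[abs_def])
    then show ?thesis
      using bounded_linear.pos_bounded[of "\<lambda>x. representation B x b"]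
      by (simp add: linear_conv_bounded_linear)
  qed
  then obtain C where C: "\<And>b. C b > 0" "\<And>b x. \<bar>representation B x b\<bar> \<le> norm x * C b"
    by metis
  \<comment> \<open>The summand 1 makes \<open>D\<close> positive without inspecting
    \<open>B\<close>.\<close>
  define D where "D = sum C B + 1"
  have D: "D > 0" unfolding D_def using C(1) by (simp add: sum_nonneg add_nonneg_pos less_imp_le)
  have sumle: "(\<Sum>b\<in>B. \<bar>real_of_int (\<rho> x b)\<bar>) \<le> norm x * D" if "x \<in> L" for x
  proof -
    have "(\<Sum>b\<in>B. \<bar>real_of_int (\<rho> x b)\<bar>) \<le> (\<Sum>b\<in>B. norm x * C b)"
      using C(2) by (intro sum_mono) (simp flip: int[OF that])
    also have "\<dots> = norm x * sum C B" by (simp add: sum_distrib_left)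
    also have "\<dots> \<le> norm x * D" by (simp add: D_def algebra_simps)
    finally show ?thesis .
  qed
  define \<gamma> where "\<gamma> = \<alpha> / D"
  have \<gamma>: "\<gamma> > 0" using \<alpha> D by (simp add: \<gamma>_def)
  have "(\<lambda>k::real^'n \<Rightarrow> int. \<Prod>b\<in>B. exp (- \<gamma> * \<bar>real_of_int (k b)\<bar>)) summable_on (B \<rightarrow>\<^sub>E UNIV)"
  proof -
    have "Infinite_Set_Sum.abs_summable_on (\<lambda>k::int. exp (- \<gamma> * \<bar>real_of_int k\<bar>)) UNIV"
      using summable_on_exp_int[OF \<gamma>] by (simp add: abs_summable_equivalent[symmetric])
    then have "Infinite_Set_Sum.abs_summable_on
        (\<lambda>k::real^'n \<Rightarrow> int. \<Prod>b\<in>B. exp (- \<gamma> * \<bar>real_of_int (k b)\<bar>)) (B \<rightarrow>\<^sub>E UNIV)"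
      by (intro abs_summable_on_prod_PiE fB) auto
    then show ?thesis
      by (simp add: abs_summable_equivalent[symmetric] prod_nonneg)
  qed
  then have "(\<lambda>k::real^'n \<Rightarrow> int. \<Prod>b\<in>B. exp (- \<gamma> * \<bar>real_of_int (k b)\<bar>)) summable_on (\<rho> ` L)"
    by (rule summable_on_subset_banach) (auto simp: \<rho>_def)
  then have "(\<lambda>x. \<Prod>b\<in>B. exp (- \<gamma> * \<bar>real_of_int (\<rho> x b)\<bar>)) summable_on L"
    by (subst (asm) summable_on_reindex[OF inj]) (simp add: o_def)
  then have "(\<lambda>x. exp (\<alpha> * (norm z + 1)) * (\<Prod>b\<in>B. exp (- \<gamma> * \<bar>real_of_int (\<rho> x b)\<bar>))) summable_on L"
    by (rule summable_on_cmult_right)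
  then show ?thesis
  proof (rule summable_on_comparison_test)
    fix x assume x: "x \<in> L"
    \<comment> \<open>This trades the quadratic exponent for a linear one, to which the coordinate
      bound applies.\<close>
    have "0 \<le> (norm (x - z) - 1 / 2)\<^sup>2" by simp
    then have "norm (x - z) - 1 \<le> (norm (x - z))\<^sup>2"
      by (simp add: power2_eq_square algebra_simps)
    moreover have "(\<Sum>b\<in>B. \<bar>real_of_int (\<rho> x b)\<bar>) / D \<le> norm x"
      using sumle[OF x] D by (simp add: divide_simps)
    moreover have "norm x \<le> norm (x - z) + norm z"
      using norm_triangle_ineq[of "x - z" z] by simp
    ultimately have "(\<Sum>b\<in>B. \<bar>real_of_int (\<rho> x b)\<bar>) / D - (norm z + 1) \<le> (norm (x - z))\<^sup>2"
      by linarith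
    then have "\<alpha> * ((\<Sum>b\<in>B. \<bar>real_of_int (\<rho> x b)\<bar>) / D - (norm z + 1)) \<le> \<alpha> * (norm (x - z))\<^sup>2"
      using \<alpha> by (intro mult_left_mono) auto
    then have "- \<alpha> * (norm (x - z))\<^sup>2
        \<le> \<alpha> * (norm z + 1) + (\<Sum>b\<in>B. - \<gamma> * \<bar>real_of_int (\<rho> x b)\<bar>)"
      unfolding sum_distrib_left[symmetric] by (simp add: \<gamma>_def algebra_simps)
    then show "exp (- \<alpha> * (norm (x - z))\<^sup>2)
        \<le> exp (\<alpha> * (norm z + 1)) * (\<Prod>b\<in>B. exp (- \<gamma> * \<bar>real_of_int (\<rho> x b)\<bar>))"
      using fB by (simp only: exp_sum[symmetric] exp_add[symmetric] exp_le_cancel_iff)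
  qed simp
qed

text \<open>Every lattice point in the ball contributes at least \<open>exp (- r\<^sup>2)\<close> to
  the convergent Gaussian sum with parameter 1, which bounds their number.\<close>

lemma full_lattice_finite_cball:
  fixes L :: "(real^'n) set"
  assumes L: "full_lattice L"
  shows "finite (L \<inter> cball z r)"
proof (rule ccontr)
  assume inf: "infinite (L \<inter> cball z r)"
  let ?f = "\<lambda>x. exp (- 1 * (norm (x - z))\<^sup>2)"
  have s: "?f summable_on L" using full_lattice_gaussian_summable[OF L, of 1 z] by simp
  obtain m where m: "infsum ?f L < real m * exp (- r\<^sup>2)"
    using ex_less_of_nat_mult[of "exp (- r\<^sup>2)" "infsum ?f L"] by auto
  obtain F where F: "finite F" "card F = m" "F \<subseteq> L \<inter> cball z r"
    using infinite_arbitrarily_large[OF inf, of m] by blast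
  have "real m * exp (- r\<^sup>2) = (\<Sum>x\<in>F. exp (- r\<^sup>2))" using F(2) by simp
  also have "\<dots> \<le> sum ?f F"
    using F(3) by (intro sum_mono) (auto simp: dist_norm norm_minus_commute intro!: power_mono)
  also have "\<dots> \<le> infsum ?f L"
    using F by (intro finite_sum_le_infsum[OF s]) auto
  finally show False using m by simp
qed

lemma full_lattice_nonempty: "full_lattice L \<Longrightarrow> L \<noteq> {}"
  unfolding full_lattice_def by blast

lemma full_lattice_closed:
  fixes L :: "(real^'n) set"
  assumes L: "full_lattice L"
  shows "closed L"
proof -
  have "\<not> z islimpt L" for z
    using full_lattice_finite_cball[OF L] zero_less_one unfolding islimpt_eq_infinite_cball by blast
  then show ?thesis by (simp add: closed_limpt)
qed

subsection \<open>Moments of spherical designs\<close>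

text \<open>Together with scaling and finite sums, monomials generate all polynomials used below, so
  later proofs need not exhibit coefficient functions.\<close>

lemma poly_fun_deg_le_monomial:
  assumes "(\<Sum>i\<in>UNIV. e i) \<le> M"
  shows "poly_fun_deg_le M (\<lambda>x::real^'n. \<Prod>i\<in>UNIV. (x $ i) ^ e i)"
  unfolding poly_fun_deg_le_def
proof (intro exI[of _ "\<lambda>e'. of_bool (e' = e)"] ext)
  fix x :: "real^'n"
  let ?m = "\<lambda>e'. \<Prod>i\<in>UNIV. (x $ i) ^ e' i"
  have "(\<Sum>e' | (\<Sum>i\<in>UNIV. e' i) \<le> M. of_bool (e' = e) * ?m e')
      = (\<Sum>e' | (\<Sum>i\<in>UNIV. e' i) \<le> M. if e' = e then ?m e' else 0)"
    by (intro sum.cong) auto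
  also have "\<dots> = ?m e"
    by (subst sum.delta) (use assms finite_exponents_le in auto)
  finally show "?m e = (\<Sum>e' | (\<Sum>i\<in>UNIV. e' i) \<le> M. of_bool (e' = e) * ?m e')" ..
qed

lemma poly_fun_deg_le_scale:
  assumes "poly_fun_deg_le M p"
  shows "poly_fun_deg_le M (\<lambda>x::real^'n. s * p x)"
proof -
  obtain a where a: "p = (\<lambda>x. \<Sum>e | (\<Sum>i\<in>UNIV. e i) \<le> M. a e * (\<Prod>i\<in>UNIV. (x $ i) ^ e i))"
    using assms unfolding poly_fun_deg_le_def by blast
  show ?thesis
    unfolding poly_fun_deg_le_def a
    by (intro exI[of _ "\<lambda>e. s * a e"]) (simp add: sum_distrib_left mult.assoc)
qed

lemma poly_fun_deg_le_sum:
  assumes "\<And>j. j \<in> J \<Longrightarrow> poly_fun_deg_le M (p j)"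
  shows "poly_fun_deg_le M (\<lambda>x::real^'n. \<Sum>j\<in>J. p j x)"
proof -
  have "\<forall>j\<in>J. \<exists>a. p j = (\<lambda>x. \<Sum>e | (\<Sum>i\<in>UNIV. e i) \<le> M. a e * (\<Prod>i\<in>UNIV. (x $ i) ^ e i))"
    using assms unfolding poly_fun_deg_le_def by blast
  from bchoice[OF this] obtain a where a: "\<And>j. j \<in> J \<Longrightarrow>
      p j = (\<lambda>x. \<Sum>e | (\<Sum>i\<in>UNIV. e i) \<le> M. a j e * (\<Prod>i\<in>UNIV. (x $ i) ^ e i))"
    by blast
  show ?thesis
    unfolding poly_fun_deg_le_def
  proof (intro exI[of _ "\<lambda>e. \<Sum>j\<in>J. a j e"] ext)
    fix x :: "real^'n"
    let ?m = "\<lambda>e. \<Prod>i\<in>UNIV. (x $ i) ^ e i"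
    have "(\<Sum>j\<in>J. p j x) = (\<Sum>j\<in>J. \<Sum>e | (\<Sum>i\<in>UNIV. e i) \<le> M. a j e * ?m e)"
      by (intro sum.cong) (simp_all add: a)
    also have "\<dots> = (\<Sum>e | (\<Sum>i\<in>UNIV. e i) \<le> M. \<Sum>j\<in>J. a j e * ?m e)"
      by (rule sum.swap)
    also have "\<dots> = (\<Sum>e | (\<Sum>i\<in>UNIV. e i) \<le> M. (\<Sum>j\<in>J. a j e) * ?m e)"
      by (simp only: sum_distrib_right)
    finally show "(\<Sum>j\<in>J. p j x) = (\<Sum>e | (\<Sum>i\<in>UNIV. e i) \<le> M. (\<Sum>j\<in>J. a j e) * ?m e)" .
  qed
qed

lemma poly_fun_deg_le_mono:
  assumes p: "poly_fun_deg_le M p" and "M \<le> N"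
  shows "poly_fun_deg_le N (p :: real^'n \<Rightarrow> real)"
proof -
  obtain a where a: "p = (\<lambda>x. \<Sum>e | (\<Sum>i\<in>UNIV. e i) \<le> M. a e * (\<Prod>i\<in>UNIV. (x $ i) ^ e i))"
    using p unfolding poly_fun_deg_le_def by blast
  show ?thesis
    unfolding a using \<open>M \<le> N\<close>
    by (intro poly_fun_deg_le_sum poly_fun_deg_le_scale poly_fun_deg_le_monomial) auto
qed

lemma poly_fun_deg_le_inner:
  fixes w :: "real^'n"
  assumes "M \<ge> 1"
  shows "poly_fun_deg_le M (\<lambda>y. y \<bullet> w)"
proof -
  have "poly_fun_deg_le M (\<lambda>y::real^'n. \<Sum>j\<in>UNIV. w $ j * (\<Prod>i\<in>UNIV. (y $ i) ^ of_bool (i = j)))"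
    using assms by (intro poly_fun_deg_le_sum poly_fun_deg_le_scale poly_fun_deg_le_monomial) simp
  moreover have "(\<Prod>i\<in>UNIV. (y $ i) ^ of_bool (i = j)) = y $ j" for y :: "real^'n" and j
  proof -
    have "(y $ i) ^ of_bool (i = j) = (if i = j then y $ i else 1)" for i by simp
    then show ?thesis by simp
  qed
  ultimately show ?thesis by (simp add: inner_vec_def mult.commute)
qed

lemma poly_fun_deg_le_inner_square:
  fixes w :: "real^'n"
  assumes "M \<ge> 2"
  shows "poly_fun_deg_le M (\<lambda>y. (y \<bullet> w)\<^sup>2)"
proof -
  \<comment> \<open>A sum of two indicators yields exponent 2 when \<open>j = k\<close>, so diagonal
    and mixed terms of the expanded square are treated alike.\<close>
  let ?e = "\<lambda>j k i. of_bool (i = j) + of_bool (i = k) :: nat"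
  have "poly_fun_deg_le M (\<lambda>y::real^'n. \<Sum>j\<in>UNIV. \<Sum>k\<in>UNIV. w $ j * w $ k *
          (\<Prod>i\<in>UNIV. (y $ i) ^ ?e j k i))"
    using assms by (intro poly_fun_deg_le_sum poly_fun_deg_le_scale poly_fun_deg_le_monomial)
      (subst sum.distrib, simp)
  moreover have "(\<Prod>i\<in>UNIV. (y $ i) ^ ?e j k i) = y $ j * y $ k" for y :: "real^'n" and j k
  proof -
    have "(y $ i) ^ ?e j k i = (if i = j then y $ i else 1) * (if i = k then y $ i else 1)" for i
      by (cases "i = j"; cases "i = k") (simp_all only: of_bool_eq power_add power_0 power_one_right if_True if_False refl)
    then have "(\<Prod>i\<in>UNIV. (y $ i) ^ ?e j k i)
        = (\<Prod>i\<in>UNIV. if i = j then y $ i else 1) * (\<Prod>i\<in>UNIV. if i = k then y $ i else 1)"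
      by (simp only: prod.distrib)
    also have "\<dots> = y $ j * y $ k" by simp
    finally show ?thesis .
  qed
  moreover have "(\<Sum>j\<in>UNIV. \<Sum>k\<in>UNIV. w $ j * w $ k * (y $ j * y $ k)) = (y \<bullet> w)\<^sup>2" for y :: "real^'n"
    unfolding inner_vec_def power2_eq_square sum_product
    by (intro sum.cong) (simp_all add: mult_ac)
  ultimately show ?thesis by (simp only:)
qed

section \<open>First and second moments of rotation invariant measures\<close>

lemma integrable_rotation_invariant_prob:
  fixes M :: "(real^'n) measure" and f :: "real^'n \<Rightarrow> real"
  assumes M: "rotation_invariant_prob r M" and f: "continuous_on UNIV f"
  shows "integrable M f"
proof -
  interpret prob_space M using M by (simp add: rotation_invariant_prob_def)
  have sM: "sets M = sets borel" and AE: "AE x in M. norm x = r"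
    using M by (auto simp: rotation_invariant_prob_def)
  \<comment> \<open>The measure is concentrated on a compact set, so a continuous function is
    essentially bounded.\<close>
  have c: "compact (f ` sphere 0 r)"
    by (intro compact_continuous_image continuous_on_subset[OF f] compact_sphere) simp
  obtain b where b: "\<And>x. x \<in> sphere 0 r \<Longrightarrow> norm (f x) \<le> b"
    using compact_imp_bounded[OF c] unfolding bounded_iff by (meson imageI)
  show ?thesis
  proof (rule integrable_const_bound)
    show "AE x in M. norm (f x) \<le> b" using AE by eventually_elim (use b in auto)
    show "f \<in> borel_measurable M"
      using borel_measurable_continuous_onI[OF f] sM by (simp cong: measurable_cong_sets)
  qed
qed

lemma integral_rotation_invariant_prob:
  fixes M :: "(real^'n) measure" and f :: "real^'n \<Rightarrow> real"
  assumes M: "rotation_invariant_prob r M" and f: "continuous_on UNIV f"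
    and T: "orthogonal_transformation T"
  shows "(\<integral>y. f (T y) \<partial>M) = (\<integral>y. f y \<partial>M)"
proof -
  have sM: "sets M = sets borel" and inv: "distr M borel T = M"
    using M T by (auto simp: rotation_invariant_prob_def)
  have "T \<in> borel_measurable borel"
    using T by (intro borel_measurable_continuous_onI linear_continuous_on)
      (simp add: orthogonal_transformation_linear flip: linear_conv_bounded_linear)
  then have Tm: "T \<in> measurable M borel" using sM by (simp cong: measurable_cong_sets)
  have "(\<integral>y. f (T y) \<partial>M) = (\<integral>y. f y \<partial>distr M borel T)"
    using borel_measurable_continuous_onI[OF f] by (subst integral_distr[OF Tm]) auto
  then show ?thesis by (simp add: inv)
qed

text \<open>The antipodal map is orthogonal and reverses the sign of the integrand.\<close>

lemma rotation_invariant_prob_mean: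
  fixes M :: "(real^'n) measure"
  assumes M: "rotation_invariant_prob r M"
  shows "(\<integral>y. y \<bullet> w \<partial>M) = 0"
proof -
  have "orthogonal_transformation (\<lambda>x::real^'n. - x)"
    by (simp add: orthogonal_transformation_neg)
  moreover have "continuous_on UNIV (\<lambda>y::real^'n. y \<bullet> w)"
    by (intro continuous_intros)
  ultimately have "(\<integral>y. - y \<bullet> w \<partial>M) = (\<integral>y. y \<bullet> w \<partial>M)"
    using integral_rotation_invariant_prob[OF M, of "\<lambda>y. y \<bullet> w" uminus] by simp
  then show ?thesis by simp
qed

text \<open>By invariance only the norm of \<open>w\<close> matters, so \<open>w\<close> may be
  turned onto any coordinate axis. Summing over all axes turns the integrand into the squared norm,
  which is constant almost everywhere.\<close>

lemma rotation_invariant_prob_second_moment: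
  fixes M :: "(real^'n) measure"
  assumes M: "rotation_invariant_prob r M"
  shows "real CARD('n) * (\<integral>y. (y \<bullet> w)\<^sup>2 \<partial>M) = r\<^sup>2 * (norm w)\<^sup>2"
proof -
  interpret prob_space M using M by (simp add: rotation_invariant_prob_def)
  have AE: "AE x in M. norm x = r"
    using M by (auto simp: rotation_invariant_prob_def)
  have cont: "continuous_on UNIV (\<lambda>y::real^'n. (y \<bullet> v)\<^sup>2)" for v
    by (intro continuous_intros)
  have ax: "(\<integral>y. (y \<bullet> w)\<^sup>2 \<partial>M) = (norm w)\<^sup>2 * (\<integral>y. (y $ i)\<^sup>2 \<partial>M)" for i
  proof -
    \<comment> \<open>This vector has the norm of \<open>w\<close>, so some orthogonal
      \<open>T\<close> maps it to \<open>w\<close>; as \<open>T\<close> preserves inner products,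
      pairing \<open>T y\<close> with \<open>w\<close> is pairing \<open>y\<close> with
      \<open>?v\<close>.\<close>
    let ?v = "norm w *\<^sub>R axis i (1::real)"
    obtain T where T: "orthogonal_transformation T" "T ?v = w"
      using orthogonal_transformation_exists[of ?v w] by auto
    have "(\<integral>y. (y \<bullet> w)\<^sup>2 \<partial>M) = (\<integral>y. (T y \<bullet> w)\<^sup>2 \<partial>M)"
      by (rule integral_rotation_invariant_prob[OF M cont T(1), symmetric])
    also have "\<dots> = (\<integral>y. (y \<bullet> ?v)\<^sup>2 \<partial>M)"
      using T by (metis orthogonal_transformation_def)
    also have "\<dots> = (\<integral>y. (norm w)\<^sup>2 * (y $ i)\<^sup>2 \<partial>M)"
      by (simp add: inner_axis power_mult_distrib)
    finally show ?thesis by simp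
  qed
  have "real CARD('n) * (\<integral>y. (y \<bullet> w)\<^sup>2 \<partial>M) = (\<Sum>i\<in>(UNIV::'n set). (norm w)\<^sup>2 * (\<integral>y. (y $ i)\<^sup>2 \<partial>M))"
    by (simp flip: ax)
  also have "\<dots> = (norm w)\<^sup>2 * (\<integral>y. (\<Sum>i\<in>UNIV. (y $ i)\<^sup>2) \<partial>M)"
    by (subst Bochner_Integration.integral_sum)
      (auto simp: sum_distrib_left intro!: integrable_rotation_invariant_prob[OF M] continuous_intros)
  also have "(\<integral>y. (\<Sum>i\<in>UNIV. (y $ i)\<^sup>2) \<partial>M) = (\<integral>y. r\<^sup>2 \<partial>M)"
  proof (rule integral_cong_AE)
    show "AE y in M. (\<Sum>i\<in>UNIV. (y $ i)\<^sup>2) = r\<^sup>2"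
      using AE by eventually_elim (auto simp: norm_vec_def L2_set_def sum_nonneg)
  qed (auto intro!: borel_measurable_integrable integrable_rotation_invariant_prob[OF M] continuous_intros)
  also have "\<dots> = r\<^sup>2" by (simp add: prob_space)
  finally show ?thesis by (simp add: mult.commute)
qed

section \<open>Transfer of the moments to designs\<close>

lemma spherical_design_mono: "spherical_design N z r X \<Longrightarrow> M \<le> N \<Longrightarrow> spherical_design M z r X"
  unfolding spherical_design_def using poly_fun_deg_le_mono by blast

text \<open>A design is non-empty, so its sphere is too. This supplies the condition under which
  \<open>sphere_measure\<close> is known to be rotation invariant.\<close>

lemma spherical_design_radius_nonneg: "spherical_design M z r X \<Longrightarrow> r \<ge> 0"
  unfolding spherical_design_def by (auto simp: sphere_def)

lemma spherical_design_mean: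
  fixes z w :: "real^'n"
  assumes X: "spherical_design M z r X" and M: "M \<ge> 1"
  shows "(\<Sum>x\<in>X. (x - z) \<bullet> w) = 0"
proof -
  have "(\<integral>y. y \<bullet> w \<partial>sphere_measure r) = 1 / real (card X) * (\<Sum>x\<in>X. (x - z) \<bullet> w)"
    using X poly_fun_deg_le_inner[OF M, of w] unfolding spherical_design_def by blast
  moreover have "card X \<noteq> 0" using X by (simp add: spherical_design_def)
  ultimately show ?thesis
    by (simp add: rotation_invariant_prob_mean[OF
          rotation_invariant_prob_sphere_measure[OF spherical_design_radius_nonneg[OF X]]])
qed

lemma spherical_design_second_moment:
  fixes z w :: "real^'n"
  assumes X: "spherical_design M z r X" and M: "M \<ge> 2"
  shows "real CARD('n) * (\<Sum>x\<in>X. ((x - z) \<bullet> w)\<^sup>2) = real (card X) * (r\<^sup>2 * (norm w)\<^sup>2)"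
proof -
  have "(\<integral>y. (y \<bullet> w)\<^sup>2 \<partial>sphere_measure r) = 1 / real (card X) * (\<Sum>x\<in>X. ((x - z) \<bullet> w)\<^sup>2)"
    using X poly_fun_deg_le_inner_square[OF M, of w] unfolding spherical_design_def by blast
  moreover have "card X \<noteq> 0" using X by (simp add: spherical_design_def)
  ultimately have "(\<Sum>x\<in>X. ((x - z) \<bullet> w)\<^sup>2) = real (card X) * (\<integral>y. (y \<bullet> w)\<^sup>2 \<partial>sphere_measure r)"
    by simp
  then show ?thesis
    by (simp add: mult.left_commute rotation_invariant_prob_second_moment[OF
          rotation_invariant_prob_sphere_measure[OF spherical_design_radius_nonneg[OF X]]])
qed

text \<open>
  With \<open>t = (x - z) \<bullet> w\<close> and \<open>m = r \<parallel>w\<parallel> / n\<close>, the moments make \<open>(t - m) (t + r \<parallel>w\<parallel>)\<close> sum to zero over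
  the design, while each of these terms would be at most zero, and not all of them zero, if
  \<open>t < m\<close> throughout.
\<close>
lemma spherical_design_inner_large:
  fixes z w :: "real^'n"
  assumes X: "spherical_design M z r X" and M: "M \<ge> 2"
  obtains x where "x \<in> X" "(x - z) \<bullet> w \<ge> r * norm w / real CARD('n)"
proof -
  let ?t = "\<lambda>x. (x - z) \<bullet> w" and ?n = "real CARD('n)"
  define s where "s = r * norm w"
  have "finite X" "X \<noteq> {}" and sph: "X \<subseteq> sphere z r" using X by (auto simp: spherical_design_def)
  have mean: "(\<Sum>x\<in>X. ?t x) = 0" using spherical_design_mean[OF X] M by simp
  have sq: "(\<Sum>x\<in>X. (?t x)\<^sup>2) = real (card X) * (s * s / ?n)"
    using spherical_design_second_moment[OF X M, of w]
    by (simp add: s_def field_simps power2_eq_square)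
  have zero: "(\<Sum>x\<in>X. (?t x - s / ?n) * (?t x + s)) = 0"
  proof -
    have "(?t x - s / ?n) * (?t x + s) = (?t x)\<^sup>2 + (s - s / ?n) * ?t x - s * s / ?n" for x
      by (simp add: left_diff_distrib right_diff_distrib distrib_left distrib_right
          power2_eq_square mult.commute)
    then show ?thesis
      by (simp add: sum.distrib sum_subtractf mean sq flip: sum_distrib_left)
  qed
  have ge: "?t x + s \<ge> 0" if "x \<in> X" for x
  proof -
    have "norm (x - z) = r" using that sph by (auto simp: dist_norm norm_minus_commute)
    then show ?thesis using Cauchy_Schwarz_ineq2[of "x - z" w] by (simp add: s_def)
  qed
  have "\<exists>x\<in>X. ?t x \<ge> s / ?n"
  proof (rule ccontr)
    assume "\<not> ?thesis"
    then have lt: "?t x < s / ?n" if "x \<in> X" for x using that by force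
    have "\<forall>x\<in>X. - ((?t x - s / ?n) * (?t x + s)) = 0"
      using \<open>finite X\<close> zero lt ge
      by (subst sum_nonneg_eq_0_iff[symmetric]) (auto simp: sum_negf mult_le_0_iff less_imp_le)
    \<comment> \<open>Strictness in \<open>lt\<close> rules out the first factor. If all inner
      products equal \<open>- s\<close>, their vanishing sum forces \<open>s = 0\<close>, and
      \<open>lt\<close> becomes \<open>0 < 0\<close>; this also disposes of the case that
      \<open>r\<close> or \<open>w\<close> is zero.\<close>
    then have eq: "?t x = - s" if "x \<in> X" for x using lt[OF that] that by force
    then have "real (card X) * s = 0" using mean by simp
    then have "s = 0" using \<open>finite X\<close> \<open>X \<noteq> {}\<close> by simp
    then show False using \<open>X \<noteq> {}\<close> eq lt by force
  qed
  then show ?thesis using that by (auto simp: s_def)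
qed

subsection \<open>The potential near a deep hole\<close>

text \<open>Write \<open>exp t\<close> as the square of \<open>exp (t / 2)\<close> and bound one
  factor below by its quadratic Taylor polynomial. The quadratic term gives the right-hand side, and
  the two lower terms absorb \<open>1 + t\<close>.\<close>

lemma exp_minus_linear_ge:
  fixes t :: real
  assumes "t \<ge> 0"
  shows "exp t - 1 - t \<ge> t\<^sup>2 / 8 * exp (t / 2)"
proof -
  let ?h = "t / 2"
  have "1 + ?h + ?h\<^sup>2 / 2 \<le> exp ?h"
    using assms by (intro exp_lower_Taylor_quadratic) simp
  then have "exp ?h * (1 + ?h + ?h\<^sup>2 / 2) \<le> exp ?h * exp ?h"
    by (intro mult_left_mono) simp_all
  also have "exp ?h * exp ?h = exp t" by (simp flip: exp_add)
  finally have "exp ?h * (1 + ?h) + ?h\<^sup>2 / 2 * exp ?h \<le> exp t"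
    by (simp add: algebra_simps)
  moreover have "(1 + ?h) * (1 + ?h) \<le> exp ?h * (1 + ?h)"
    using assms by (intro mult_right_mono exp_ge_add_one_self) simp_all
  moreover have "(1 + ?h) * (1 + ?h) \<ge> 1 + t"
    by (simp add: algebra_simps)
  ultimately show ?thesis by (simp add: power_divide)
qed

text \<open>This is \<open>1 - u \<le> exp (- u)\<close> multiplied by \<open>exp u\<close>.\<close>

lemma exp_minus_one_le:
  fixes u :: real
  shows "exp u - 1 \<le> u * exp u"
proof -
  have "(1 + - u) * exp u \<le> exp (- u) * exp u"
    by (intro mult_right_mono exp_ge_add_one_self) simp
  then show ?thesis by (simp add: algebra_simps flip: exp_add)
qed

text \<open>The shells around \<open>c\<close> partition \<open>L\<close>, and summability allows
  the sum to be grouped by radius.\<close>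

lemma infsum_shells_eq_zero:
  fixes f :: "real^'n \<Rightarrow> real"
  assumes "f summable_on L" and "\<And>r. (\<Sum>\<^sub>\<infinity>x\<in>shell L c r. f x) = 0"
  shows "infsum f L = 0"
proof -
  \<comment> \<open>The radius ranges over all reals; a radius that no lattice point attains has an
    empty shell and adds nothing.\<close>
  let ?A = "SIGMA r:UNIV. shell L c r"
  have bij: "bij_betw snd ?A L"
    by (rule bij_betw_byWitness[where f' = "\<lambda>x. (norm (x - c), x)"]) (auto simp: shell_def)
  have "(\<lambda>p. f (snd p)) summable_on ?A"
    using assms(1) by (subst summable_on_reindex_bij_betw[OF bij])
  then have "infsum (\<lambda>r. infsum f (shell L c r)) UNIV = infsum (\<lambda>p. f (snd p)) ?A"
    using infsum_Sigma_banach[of "\<lambda>p. f (snd p)" UNIV "shell L c"] by simp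
  also have "\<dots> = infsum f L" by (rule infsum_reindex_bij_betw[OF bij])
  finally show ?thesis by (simp add: assms(2))
qed

text \<open>Otherwise every point would have distance 0 from the closed set \<open>L\<close>, making
  \<open>L\<close> the whole space, although it meets every ball in a finite set.\<close>

lemma deep_hole_infdist_pos:
  fixes L :: "(real^'n) set"
  assumes L: "full_lattice L" and c: "deep_hole L c"
  shows "infdist c L > 0"
proof (rule ccontr)
  assume "\<not> ?thesis"
  then have "infdist z L = 0" for z
    using c infdist_nonneg[of z L] unfolding deep_hole_def by (meson antisym not_less order_trans)
  then have "L = UNIV"
    using in_closed_iff_infdist_zero[OF full_lattice_closed[OF L] full_lattice_nonempty[OF L]] by blast
  then have "finite (cball (0 :: real^'n) 1)"
    using full_lattice_finite_cball[OF L, of 0 1] by simp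
  then show False
    using uncountable_cball[of 1 "0 :: real^'n"] countable_finite by auto
qed

text \<open>Expanding the square of \<open>(x - c) - (z - c)\<close> splits off a factor common to
  all lattice points and leaves the dependence on direction in the last exponential.\<close>

lemma gaussian_expand:
  fixes x c z :: "real^'n"
  shows "exp (- \<alpha> * (norm (x - z))\<^sup>2)
    = exp (- \<alpha> * (norm (z - c))\<^sup>2) * (exp (- \<alpha> * (norm (x - c))\<^sup>2) * exp (2 * \<alpha> * ((x - c) \<bullet> (z - c))))"
proof -
  have "(norm (x - z))\<^sup>2 = (norm ((x - c) - (z - c)))\<^sup>2" by simp
  also have "\<dots> = (norm (x - c))\<^sup>2 + (norm (z - c))\<^sup>2 - 2 * ((x - c) \<bullet> (z - c))"
    using dot_norm_neg[of "x - c" "z - c"] by simp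
  finally have "- \<alpha> * (norm (x - z))\<^sup>2 = - \<alpha> * (norm (z - c))\<^sup>2
      + (- \<alpha> * (norm (x - c))\<^sup>2 + 2 * \<alpha> * ((x - c) \<bullet> (z - c)))"
    by (simp only: right_diff_distrib distrib_left)
  then show ?thesis by (simp only: exp_add)
qed

text \<open>The linear factor is dominated by \<open>exp t + exp (- t)\<close>. Completing the
  square turns these two exponentials, times the Gaussian at \<open>c\<close>, into Gaussians
  centered at \<open>c + w\<close> and \<open>c - w\<close>.\<close>

lemma gaussian_moment_summable:
  fixes L :: "(real^'n) set"
  assumes L: "full_lattice L" and \<alpha>: "\<alpha> > 0"
  shows "(\<lambda>x. exp (- \<alpha> * (norm (x - c))\<^sup>2) * (2 * \<alpha> * ((x - c) \<bullet> w))) summable_on L"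
proof -
  \<comment> \<open>The prefactor cancels the factor that \<open>gaussian_expand\<close> produces
    for a shift by a vector of the norm of \<open>w\<close>.\<close>
  let ?E = "\<lambda>v x. exp (\<alpha> * (norm w)\<^sup>2) * exp (- \<alpha> * (norm (x - (c + v)))\<^sup>2)"
  have "(\<lambda>x. ?E w x + ?E (- w) x) summable_on L"
    by (intro summable_on_add summable_on_cmult_right full_lattice_gaussian_summable L \<alpha>)
  then have "(\<lambda>x. norm (exp (- \<alpha> * (norm (x - c))\<^sup>2) * (2 * \<alpha> * ((x - c) \<bullet> w)))) summable_on L"
  proof (rule Infinite_Sum.abs_summable_on_comparison_test')
    fix x
    let ?t = "2 * \<alpha> * ((x - c) \<bullet> w)"
    have E: "?E v x = exp (- \<alpha> * (norm (x - c))\<^sup>2) * exp (2 * \<alpha> * ((x - c) \<bullet> v))"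
      if "norm v = norm w" for v
      using that unfolding gaussian_expand[of \<alpha> x "c + v" c] by (simp flip: exp_add)
    have EE: "?E w x + ?E (- w) x = exp (- \<alpha> * (norm (x - c))\<^sup>2) * (exp ?t + exp (- ?t))"
      using E[of w] E[of "- w"] by (simp only: norm_minus_cancel inner_minus_right mult_minus_right distrib_left)
    have "\<bar>?t\<bar> \<le> exp ?t + exp (- ?t)"
      using exp_ge_add_one_self[of ?t] exp_ge_add_one_self[of "- ?t"]
        exp_gt_zero[of ?t] exp_gt_zero[of "- ?t"] by linarith
    then have "exp (- \<alpha> * (norm (x - c))\<^sup>2) * \<bar>?t\<bar>
        \<le> exp (- \<alpha> * (norm (x - c))\<^sup>2) * (exp ?t + exp (- ?t))"
      by (intro mult_left_mono) simp_all
    then show "norm (exp (- \<alpha> * (norm (x - c))\<^sup>2) * ?t) \<le> ?E w x + ?E (- w) x"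
      unfolding EE by (simp add: abs_mult)
  qed
  then show ?thesis by (rule abs_summable_summable)
qed

text \<open>The Gaussian weight is constant on each shell, so every shell sum is a multiple of the
  first moment of a design and vanishes.\<close>

lemma gaussian_moment_eq_zero:
  fixes L :: "(real^'n) set"
  assumes L: "full_lattice L" and \<alpha>: "\<alpha> > 0"
    and X: "\<And>r. shell L c r \<noteq> {} \<Longrightarrow> spherical_design 1 c r (shell L c r)"
  shows "(\<Sum>\<^sub>\<infinity>x\<in>L. exp (- \<alpha> * (norm (x - c))\<^sup>2) * (2 * \<alpha> * ((x - c) \<bullet> w))) = 0"
proof (rule infsum_shells_eq_zero[where c = c, OF gaussian_moment_summable[OF L \<alpha>]])
  fix r
  let ?f = "\<lambda>x. exp (- \<alpha> * (norm (x - c))\<^sup>2) * (2 * \<alpha> * ((x - c) \<bullet> w))"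
  show "infsum ?f (shell L c r) = 0"
  proof (cases "shell L c r = {}")
    case False
    then have "finite (shell L c r)" using X by (simp add: spherical_design_def)
    then have "infsum ?f (shell L c r) = sum ?f (shell L c r)" by (rule infsum_finite)
    also have "\<dots> = (\<Sum>x\<in>shell L c r. exp (- \<alpha> * r\<^sup>2) * (2 * \<alpha>) * ((x - c) \<bullet> w))"
      by (intro sum.cong) (auto simp: shell_def)
    also have "\<dots> = exp (- \<alpha> * r\<^sup>2) * (2 * \<alpha>) * (\<Sum>x\<in>shell L c r. (x - c) \<bullet> w)"
      by (rule sum_distrib_left[symmetric])
    finally show ?thesis using spherical_design_mean[OF X[OF False]] by simp
  qed simp
qed

text \<open>Since the linear terms cancel over \<open>L\<close>, the sum may be rewritten with
  \<open>exp t - 1 - t\<close>. These terms are nonnegative, and only the one at \<open>x\<close> is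
  kept.\<close>

lemma gaussian_potential_ge:
  fixes L :: "(real^'n) set"
  assumes L: "full_lattice L" and \<alpha>: "\<alpha> > 0"
    and X: "\<And>r. shell L c r \<noteq> {} \<Longrightarrow> spherical_design 1 c r (shell L c r)"
    and x: "x \<in> L" and t: "t = 2 * \<alpha> * ((x - c) \<bullet> (z - c))"
  shows "gaussian_potential \<alpha> L z \<ge> exp (- \<alpha> * (norm (z - c))\<^sup>2) *
    (gaussian_potential \<alpha> L c + exp (- \<alpha> * (norm (x - c))\<^sup>2) * (exp t - 1 - t))"
proof -
  let ?g = "\<lambda>y. exp (- \<alpha> * (norm (y - c))\<^sup>2)" and ?t = "\<lambda>y. 2 * \<alpha> * ((y - c) \<bullet> (z - c))"
  have g: "?g summable_on L" by (rule full_lattice_gaussian_summable[OF L \<alpha>])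
  have gt: "(\<lambda>y. ?g y * ?t y) summable_on L" by (rule gaussian_moment_summable[OF L \<alpha>])
  have gt0: "(\<Sum>\<^sub>\<infinity>y\<in>L. ?g y * ?t y) = 0"
    using L \<alpha> X by (rule gaussian_moment_eq_zero)
  have "(\<lambda>y. exp (- \<alpha> * (norm (z - c))\<^sup>2) * (?g y * exp (?t y))) summable_on L"
    unfolding gaussian_expand[of \<alpha> _ z c, symmetric] by (rule full_lattice_gaussian_summable[OF L \<alpha>])
  then have ge: "(\<lambda>y. ?g y * exp (?t y)) summable_on L"
    by (simp add: summable_on_cmult_right')
  have d: "(\<lambda>y. ?g y * (exp (?t y) - 1 - ?t y)) summable_on L"
    using summable_on_add[OF ge summable_on_cmult_right[OF summable_on_add[OF g gt], of "-1"]] by (simp add: algebra_simps)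
  have "gaussian_potential \<alpha> L z = exp (- \<alpha> * (norm (z - c))\<^sup>2) * (\<Sum>\<^sub>\<infinity>y\<in>L. ?g y * exp (?t y))"
    unfolding gaussian_potential_def gaussian_expand[of \<alpha> _ z c] by (rule infsum_cmult_right[OF ge])
  also have "(\<Sum>\<^sub>\<infinity>y\<in>L. ?g y * exp (?t y))
      = (\<Sum>\<^sub>\<infinity>y\<in>L. (?g y + ?g y * ?t y) + ?g y * (exp (?t y) - 1 - ?t y))"
    by (simp add: algebra_simps)
  also have "\<dots> = gaussian_potential \<alpha> L c
      + (\<Sum>\<^sub>\<infinity>y\<in>L. ?g y * (exp (?t y) - 1 - ?t y))"
    unfolding infsum_add[OF summable_on_add[OF g gt] d] infsum_add[OF g gt] gt0
      gaussian_potential_def by simp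
  finally have eq: "gaussian_potential \<alpha> L z = exp (- \<alpha> * (norm (z - c))\<^sup>2) *
      (gaussian_potential \<alpha> L c + (\<Sum>\<^sub>\<infinity>y\<in>L. ?g y * (exp (?t y) - 1 - ?t y)))" .
  have "?g x * (exp t - 1 - t) \<le> (\<Sum>\<^sub>\<infinity>y\<in>L. ?g y * (exp (?t y) - 1 - ?t y))"
  proof -
    have "sum (\<lambda>y. ?g y * (exp (?t y) - 1 - ?t y)) {x} \<le> (\<Sum>\<^sub>\<infinity>y\<in>L. ?g y * (exp (?t y) - 1 - ?t y))"
    proof (rule finite_sum_le_infsum[OF d])
      show "0 \<le> ?g y * (exp (?t y) - 1 - ?t y)" for y
      proof (rule mult_nonneg_nonneg)
        show "0 \<le> exp (?t y) - 1 - ?t y"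
          using exp_ge_add_one_self[of "?t y"] by linarith
      qed simp
    qed (use x in auto)
    then show ?thesis using t by simp
  qed
  then show ?thesis unfolding eq by (intro mult_left_mono add_left_mono) simp_all
qed

text \<open>No lattice point is closer to \<open>c\<close> than \<open>infdist c L\<close>, so the
  surplus \<open>\<alpha> - \<beta>\<close> of the exponent is estimated uniformly. What remains is
  a constant independent of \<open>\<alpha>\<close>.\<close>

lemma gaussian_potential_le:
  fixes L :: "(real^'n) set"
  assumes L: "full_lattice L" and \<alpha>: "\<alpha> \<ge> \<beta>" "\<beta> > 0"
  shows "gaussian_potential \<alpha> L c
    \<le> exp (- (\<alpha> - \<beta>) * (infdist c L)\<^sup>2) * gaussian_potential \<beta> L c"
proof -
  have s: "(\<lambda>x. exp (- a * (norm (x - c))\<^sup>2)) summable_on L" if "a > 0" for a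
    using L that by (rule full_lattice_gaussian_summable)
  have "gaussian_potential \<alpha> L c
      \<le> (\<Sum>\<^sub>\<infinity>x\<in>L. exp (- (\<alpha> - \<beta>) * (infdist c L)\<^sup>2) * exp (- \<beta> * (norm (x - c))\<^sup>2))"
    unfolding gaussian_potential_def
  proof (rule infsum_mono)
    fix x assume "x \<in> L"
    then have "(infdist c L)\<^sup>2 \<le> (norm (x - c))\<^sup>2"
      using infdist_le[of x L c] by (intro power_mono infdist_nonneg) (simp add: dist_norm norm_minus_commute)
    then have "(\<alpha> - \<beta>) * (infdist c L)\<^sup>2 \<le> (\<alpha> - \<beta>) * (norm (x - c))\<^sup>2"
      using \<alpha> by (intro mult_left_mono) auto
    then show "exp (- \<alpha> * (norm (x - c))\<^sup>2)
        \<le> exp (- (\<alpha> - \<beta>) * (infdist c L)\<^sup>2) * exp (- \<beta> * (norm (x - c))\<^sup>2)"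
      by (simp add: algebra_simps flip: exp_add)
  qed (use \<alpha> in \<open>intro s summable_on_cmult_right; simp\<close>)+
  then show ?thesis
    using s[OF \<alpha>(2)] by (simp add: gaussian_potential_def infsum_cmult_right)
qed

theorem theorem2p5:
  fixes L :: "(real^'n) set" and c :: "real^'n"
  assumes "full_lattice L"
    and "deep_hole L c"
    and "\<And>r. shell L c r \<noteq> {} \<Longrightarrow> spherical_design 2 c r (shell L c r)"
  shows "\<exists>\<alpha>\<^sub>c > 0. \<exists>R > 0. \<forall>\<alpha> \<ge> \<alpha>\<^sub>c. \<forall>z \<in> cball c R. z \<noteq> c \<longrightarrow>
           gaussian_potential \<alpha> L z > gaussian_potential \<alpha> L c"
proof -
  note L = assms(1)
  have X: "spherical_design 1 c r (shell L c r)" if "shell L c r \<noteq> {}" for r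
    using assms(3)[OF that] by (rule spherical_design_mono) simp
  define r where "r = infdist c L"
  have r: "r > 0" unfolding r_def using L assms(2) by (rule deep_hole_infdist_pos)
  obtain x0 where "x0 \<in> L" "r = dist c x0"
    using infdist_attains_inf[OF full_lattice_closed[OF L] full_lattice_nonempty[OF L]]
    unfolding r_def by blast
  then have "shell L c r \<noteq> {}" by (auto simp: shell_def dist_norm norm_minus_commute)
  note first = assms(3)[OF this]
  \<comment> \<open>With \<open>u = norm (z - c)\<close>, the design supplies a point of the
    innermost shell whose inner product with \<open>z - c\<close> is at least \<open>R * u\<close>.
    Taking the same \<open>R\<close> as radius ensures \<open>u\<^sup>2 \<le> R * u\<close>.\<close>
  define R where "R = r / real CARD('n)"
  have R: "R > 0" using r by (simp add: R_def)
  \<comment> \<open>With parameter 1 as reference, the potential at \<open>c\<close> is at most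
    \<open>K * exp (- \<alpha> * r\<^sup>2)\<close> for all \<open>\<alpha> \<ge> 1\<close>.\<close>
  define K where "K = exp (r\<^sup>2) * gaussian_potential 1 L c"
  have K: "K \<ge> 0" by (simp add: K_def gaussian_potential_def infsum_nonneg)
  \<comment> \<open>The second summand is the threshold beyond which
    \<open>\<alpha> * R\<^sup>2 / 2\<close> exceeds \<open>K\<close>. Adding 1 makes that comparison
    strict and ensures \<open>\<alpha> \<ge> 1\<close>.\<close>
  define A where "A = 1 + 2 * K / R\<^sup>2"
  have A: "A \<ge> 1" using K by (simp add: A_def)
  show ?thesis
  proof (rule exI[of _ A], intro conjI exI[of _ R] allI ballI impI)
    fix \<alpha> z assume "A \<le> \<alpha>" "z \<in> cball c R" "z \<noteq> c"
    then have \<alpha>: "\<alpha> \<ge> 1" using A by simp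
    define u where "u = norm (z - c)"
    have u: "0 < u" "u \<le> R"
      using \<open>z \<in> cball c R\<close> \<open>z \<noteq> c\<close> by (auto simp: u_def dist_norm norm_minus_commute)
    obtain x where x: "x \<in> shell L c r" "(x - c) \<bullet> (z - c) \<ge> R * u"
      using spherical_design_inner_large[OF first, of "z - c"] by (auto simp: R_def u_def)
    then have xL: "x \<in> L" and xr: "norm (x - c) = r" by (auto simp: shell_def)
    define t where "t = 2 * \<alpha> * ((x - c) \<bullet> (z - c))"
    have t: "t \<ge> 2 * \<alpha> * (R * u)"
      unfolding t_def using x(2) \<alpha> by (intro mult_left_mono) auto
    have t0: "2 * \<alpha> * (R * u) \<ge> 0" using \<alpha> R u by simp
    \<comment> \<open>The loss is of order \<open>\<alpha> * u\<^sup>2\<close>, while the gain from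
      the single point carries the extra factor \<open>\<alpha> * R\<^sup>2 / 2\<close>, which beats
      \<open>K\<close>.\<close>
    have "K * (exp (\<alpha> * u\<^sup>2) - 1) \<le> K * (\<alpha> * u\<^sup>2 * exp (\<alpha> * u\<^sup>2))"
      using K by (intro mult_left_mono exp_minus_one_le)
    also have "\<dots> = (\<alpha> * u\<^sup>2) * exp (\<alpha> * u\<^sup>2) * K" by simp
    also have "\<dots> < (\<alpha> * u\<^sup>2) * exp (\<alpha> * u\<^sup>2) * (\<alpha> * R\<^sup>2 / 2)"
    proof (rule mult_strict_left_mono)
      have "2 * K / R\<^sup>2 < \<alpha>" using \<open>A \<le> \<alpha>\<close> by (simp add: A_def)
      then show "K < \<alpha> * R\<^sup>2 / 2" using R by (simp add: field_simps)
    qed (use \<alpha> u in simp)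
    also have "\<dots> = (2 * \<alpha> * (R * u))\<^sup>2 / 8 * exp (\<alpha> * u\<^sup>2)"
      by (simp add: power2_eq_square)
    also have "\<dots> \<le> t\<^sup>2 / 8 * exp (t / 2)"
    proof (intro mult_mono)
      show "(2 * \<alpha> * (R * u))\<^sup>2 / 8 \<le> t\<^sup>2 / 8"
        using t t0 by (intro divide_right_mono power_mono) auto
      \<comment> \<open>Here \<open>u \<le> R\<close> enters: the exponential growth of the loss is
        matched by the factor \<open>exp (t / 2)\<close> of the gain.\<close>
      have "\<alpha> * u\<^sup>2 \<le> \<alpha> * (R * u)"
        unfolding power2_eq_square using \<alpha> u by (intro mult_left_mono mult_right_mono) auto
      then show "exp (\<alpha> * u\<^sup>2) \<le> exp (t / 2)" using t by simp
    qed simp_all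
    also have "\<dots> \<le> exp t - 1 - t"
      using order_trans[OF t0 t] by (rule exp_minus_linear_ge)
    finally have E: "K * (exp (\<alpha> * u\<^sup>2) - 1) < exp t - 1 - t" .
    have "gaussian_potential \<alpha> L c \<le> exp (- (\<alpha> - 1) * r\<^sup>2) * gaussian_potential 1 L c"
      unfolding r_def using \<alpha> by (intro gaussian_potential_le[OF L]) auto
    also have "\<dots> = exp (- \<alpha> * r\<^sup>2) * K"
      by (simp add: K_def algebra_simps flip: exp_add)
    finally have "gaussian_potential \<alpha> L c * (exp (\<alpha> * u\<^sup>2) - 1)
        \<le> exp (- \<alpha> * r\<^sup>2) * K * (exp (\<alpha> * u\<^sup>2) - 1)"
      using \<alpha> by (intro mult_right_mono) auto
    also have "\<dots> < exp (- \<alpha> * r\<^sup>2) * (exp t - 1 - t)"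
      using E by (simp add: mult.assoc)
    \<comment> \<open>The left side is the potential at \<open>c\<close> with a cancelling pair of
      factors inserted; the right side is the lower bound of
      \<open>gaussian_potential_ge\<close>.\<close>
    finally have "exp (- \<alpha> * u\<^sup>2) * (gaussian_potential \<alpha> L c * exp (\<alpha> * u\<^sup>2))
        < exp (- \<alpha> * u\<^sup>2) * (gaussian_potential \<alpha> L c + exp (- \<alpha> * r\<^sup>2) * (exp t - 1 - t))"
      by (intro mult_strict_left_mono) (simp_all add: algebra_simps)
    also have "\<dots> \<le> gaussian_potential \<alpha> L z"
      unfolding u_def xr[symmetric] using \<alpha>
      by (intro gaussian_potential_ge[OF L _ X xL t_def]) auto
    finally show "gaussian_potential \<alpha> L c < gaussian_potential \<alpha> L z"
      by (simp add: mult.left_commute flip: exp_add)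
  qed (use A R in auto)
qed

end
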